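(* Let $G$ be a $g$-expectation and let $V=(V_t)_{0\le t\le T}$ be a $g$-supermartingale with respect to $G$. Then for any stopping times $\sigma,\tau$ with $0\le\sigma\le\tau\le T$, $$V_\sigma\ge G(V_\tau|\mathcal{F}_\sigma)\quad P\text{-a.s.}$$ Similarly, if $V$ is a $g$-submartingale, then $V_\sigma\le G(V_\tau|\mathcal{F}_\sigma)$ $P$-a.s. for all such $\sigma,\tau$.
   Context: Setting: $T$ is a positive integer, $m\ge 1$, and $X=(X_t)_{0\le t\le T}$ is a stochastic process with values in the set of standard basis vectors of $\mathbb{R}^m$ on a probability space $(\Omega,\mathcal{F},P)$; $\mathcal{F}_t$ is the completion of $\sigma(X_0,\dots,X_t)$ and $\mathcal{F}=\mathcal{F}_T$. Stopping times are with respect to $(\mathcal{F}_t)$ and take values in $\{0,1,\dots,T\}$. A $g$-expectation (equivalently, a filtration consistent, translation invariant nonlinear expectation) is a system of operators $G(\cdot|\mathcal{F}_t):L^1(\mathcal{F}_T;\mathbb{R})\to L^1(\mathcal{F}_t;\mathbb{R})$, $0\le t\le T$, such that for all $\xi,\xi'\in L^1(\mathcal{F}_T;\mathbb{R})$ and all $t$: (i) if $\xi\ge\xi'$ $P$-a.s. then $G(\xi|\mathcal{F}_t)\ge G(\xi'|\mathcal{F}_t)$ $P$-a.s.; (ii) $G(\xi|\mathcal{F}_t)=\xi$ for every $\mathcal{F}_t$-measurable $\xi$; (iii) $G(G(\xi|\mathcal{F}_t)|\mathcal{F}_s)=G(\xi|\mathcal{F}_s)$ for all $s<t$; (iv) $I_A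 G(\xi|\mathcal{F}_t)=G(I_A\xi|\mathcal{F}_t)$ for every $A\in\mathcal{F}_t$; (v) $G(\xi+q|\mathcal{F}_t)=G(\xi|\mathcal{F}_t)+q$ for every $q\in L^1(\mathcal{F}_t;\mathbb{R})$. For a stopping time $\sigma$, $G(\xi|\mathcal{F}_\sigma)$ is the value at time $\sigma$ of the process $t\mapsto G(\xi|\mathcal{F}_t)$, i.e. $G(\xi|\mathcal{F}_\sigma)=\sum_{t=0}^T I_{\{\sigma=t\}}G(\xi|\mathcal{F}_t)$. A process $V$ is a $g$-supermartingale if $V_t\in L^1(\mathcal{F}_t;\mathbb{R})$ for all $t$ and $V_s\ge G(V_t|\mathcal{F}_s)$ $P$-a.s. for all $s\le t$; a $g$-submartingale if instead $V_s\le G(V_t|\mathcal{F}_s)$. *)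

theory Defs
  imports "HOL-Probability.Probability"
begin

definition generated_sigma :: "'a measure \<Rightarrow> (nat \<Rightarrow> 'a \<Rightarrow> real ^ 'm) \<Rightarrow> nat \<Rightarrow> 'a measure" where
  "generated_sigma M X t =
     sigma (space M) (\<Union>s\<le>t. sets (vimage_algebra (space M) (X s) borel))"

text \<open>
  The filtration at time \<open>t\<close> is a measure space, not just a sigma-algebra: it carries \<open>P\<close>
  restricted to the sigma-algebra generated by \<open>X\<^sub>0, \<dots>, X\<^sub>t\<close> and then completed.  Hence
  \<open>integrable (filt M X t) \<xi>\<close> says that \<open>\<xi>\<close> belongs to \<open>L\<^sup>1\<close> of the sigma-algebra at time \<open>t\<close>.
\<close>

definition filt :: "'a measure \<Rightarrow> (nat \<Rightarrow> 'a \<Rightarrow> real ^ 'm) \<Rightarrow> nat \<Rightarrow> 'a measure" where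
  "filt M X t = completion (restr_to_subalg M (generated_sigma M X t))"

text \<open>
  Only the values \<open>X t\<close> with \<open>t \<le> T\<close> matter; the same convention is used for all processes below.
\<close>

locale finite_state_process = prob_space M
  for M :: "'a measure" and X :: "nat \<Rightarrow> 'a \<Rightarrow> real ^ 'm" and T :: nat +
  assumes T_pos: "T > 0"
    and X_measurable: "\<And>t. t \<le> T \<Longrightarrow> X t \<in> borel_measurable M"
    and X_basis: "\<And>t \<omega>. t \<le> T \<Longrightarrow> \<omega> \<in> space M \<Longrightarrow> X t \<omega> \<in> cart_basis"
    and sets_M: "sets M = sets (filt M X T)"

text \<open>
  Elements of \<open>L\<^sup>1\<close> are represented by integrable functions and their equality by almost sure
  equality.  Monotonicity makes each operator respect almost sure equality, so that it
  does act on equivalence classes.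
\<close>

locale g_expectation =
  fixes M :: "'a measure" and F :: "nat \<Rightarrow> 'a measure" and T :: nat
    and G :: "nat \<Rightarrow> ('a \<Rightarrow> real) \<Rightarrow> 'a \<Rightarrow> real"
  assumes G_integrable:
      "\<And>t \<xi>. t \<le> T \<Longrightarrow> integrable (F T) \<xi> \<Longrightarrow> integrable (F t) (G t \<xi>)"
    and G_mono:
      "\<And>t \<xi> \<xi>'. t \<le> T \<Longrightarrow> integrable (F T) \<xi> \<Longrightarrow> integrable (F T) \<xi>' \<Longrightarrow>
         AE \<omega> in M. \<xi> \<omega> \<ge> \<xi>' \<omega> \<Longrightarrow> AE \<omega> in M. G t \<xi> \<omega> \<ge> G t \<xi>' \<omega>"
    and G_measurable_id:
      "\<And>t \<xi>. t \<le> T \<Longrightarrow> integrable (F T) \<xi> \<Longrightarrow> \<xi> \<in> borel_measurable (F t) \<Longrightarrow>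
         AE \<omega> in M. G t \<xi> \<omega> = \<xi> \<omega>"
    and G_tower:
      "\<And>s t \<xi>. s < t \<Longrightarrow> t \<le> T \<Longrightarrow> integrable (F T) \<xi> \<Longrightarrow>
         AE \<omega> in M. G s (G t \<xi>) \<omega> = G s \<xi> \<omega>"
    and G_indicator:
      "\<And>t \<xi> A. t \<le> T \<Longrightarrow> integrable (F T) \<xi> \<Longrightarrow> A \<in> sets (F t) \<Longrightarrow>
         AE \<omega> in M. indicator A \<omega> * G t \<xi> \<omega> = G t (\<lambda>\<omega>. indicator A \<omega> * \<xi> \<omega>) \<omega>"
    and G_translation:
      "\<And>t \<xi> q. t \<le> T \<Longrightarrow> integrable (F T) \<xi> \<Longrightarrow> integrable (F t) q \<Longrightarrow>
         AE \<omega> in M. G t (\<lambda>\<omega>. \<xi> \<omega> + q \<omega>) \<omega> = G t \<xi> \<omega> + q \<omega>"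

definition at_time :: "(nat \<Rightarrow> 'a \<Rightarrow> real) \<Rightarrow> ('a \<Rightarrow> nat) \<Rightarrow> 'a \<Rightarrow> real" where
  "at_time V \<tau> \<omega> = V (\<tau> \<omega>) \<omega>"

definition G_stopped ::
  "nat \<Rightarrow> (nat \<Rightarrow> ('a \<Rightarrow> real) \<Rightarrow> 'a \<Rightarrow> real) \<Rightarrow> ('a \<Rightarrow> nat) \<Rightarrow> ('a \<Rightarrow> real) \<Rightarrow> 'a \<Rightarrow> real" where
  "G_stopped T G \<sigma> \<xi> \<omega> = (\<Sum>t\<le>T. indicator {\<omega>. \<sigma> \<omega> = t} \<omega> * G t \<xi> \<omega>)"

definition g_supermartingale ::
  "'a measure \<Rightarrow> (nat \<Rightarrow> 'a measure) \<Rightarrow> nat \<Rightarrow> (nat \<Rightarrow> ('a \<Rightarrow> real) \<Rightarrow> 'a \<Rightarrow> real)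
    \<Rightarrow> (nat \<Rightarrow> 'a \<Rightarrow> real) \<Rightarrow> bool" where
  "g_supermartingale M F T G V \<longleftrightarrow>
     (\<forall>t\<le>T. integrable (F t) (V t)) \<and>
     (\<forall>t\<le>T. \<forall>s\<le>t. AE \<omega> in M. V s \<omega> \<ge> G s (V t) \<omega>)"

definition g_submartingale ::
  "'a measure \<Rightarrow> (nat \<Rightarrow> 'a measure) \<Rightarrow> nat \<Rightarrow> (nat \<Rightarrow> ('a \<Rightarrow> real) \<Rightarrow> 'a \<Rightarrow> real)
    \<Rightarrow> (nat \<Rightarrow> 'a \<Rightarrow> real) \<Rightarrow> bool" where
  "g_submartingale M F T G V \<longleftrightarrow>
     (\<forall>t\<le>T. integrable (F t) (V t)) \<and>
     (\<forall>t\<le>T. \<forall>s\<le>t. AE \<omega> in M. V s \<omega> \<le> G s (V t) \<omega>)"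

end

theory Submission
  imports Defs
begin

text \<open>
  For a supermartingale, backward induction on \<open>t\<close> gives \<open>G (V\<^sub>\<tau> | F\<^sub>t) \<le> V\<^bsub>\<tau> \<and> t\<^esub>\<close> for every
  \<open>t \<le> T\<close>: write \<open>V\<^bsub>\<tau> \<and> (t + 1)\<^esub> = 1\<^bsub>\<tau> \<le> t\<^esub> V\<^bsub>\<tau> \<and> t\<^esub> + 1\<^bsub>\<tau> > t\<^esub> V\<^bsub>t + 1\<^esub>\<close>, pull the first summand out of
  \<open>G (\<cdot> | F\<^sub>t)\<close> by translation invariance and the indicator in the second one out by the
  zero-one law.  On \<open>\<sigma> = t\<close> the bound reads \<open>G (V\<^sub>\<tau> | F\<^sub>t) \<le> V\<^sub>t\<close> because \<open>\<sigma> \<le> \<tau>\<close>.  The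
  submartingale case follows by applying this to \<open>-V\<close> and the dual expectation \<open>-G (-\<xi>)\<close>.
\<close>

section \<open>The completed natural filtration\<close>

lemma emeasure_sandwich_null:
  assumes "S \<in> sets M" "A \<in> sets M" "N \<in> null_sets M" "S \<subseteq> A" "A \<subseteq> S \<union> N"
  shows "emeasure M A = emeasure M S"
proof (rule antisym)
  have "emeasure M A \<le> emeasure M (S \<union> N)"
    using assms by (intro emeasure_mono) auto
  also have "\<dots> = emeasure M S"
    using assms by (intro emeasure_Un_null_set)
  finally show "emeasure M A \<le> emeasure M S" .
  show "emeasure M S \<le> emeasure M A"
    using assms by (intro emeasure_mono)
qed

lemma null_sets_restr_to_subalg_mono:
  assumes "subalgebra M F" "subalgebra M F'" "sets F \<subseteq> sets F'"
  shows "null_sets (restr_to_subalg M F) \<subseteq> null_sets (restr_to_subalg M F')"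
  using assms by (auto simp: null_sets_def sets_restr_to_subalg emeasure_restr_to_subalg subset_iff)

text \<open>A null set of the smaller sigma-algebra stays null in the larger one, so a decomposition
  into a measurable set and a part of a null set carries over.\<close>

lemma sets_completion_restr_to_subalg_mono:
  assumes "subalgebra M F" "subalgebra M F'" "sets F \<subseteq> sets F'"
  shows "sets (completion (restr_to_subalg M F)) \<subseteq> sets (completion (restr_to_subalg M F'))"
proof
  fix A assume "A \<in> sets (completion (restr_to_subalg M F))"
  then obtain S N N' where A: "A = S \<union> N" "N \<subseteq> N'" "N' \<in> null_sets (restr_to_subalg M F)"
      "S \<in> sets (restr_to_subalg M F)"
    by (rule sets_completionE)
  show "A \<in> sets (completion (restr_to_subalg M F'))"
    using A null_sets_restr_to_subalg_mono[OF assms] assms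
    by (intro sets_completionI[of A S N N']) (auto simp: sets_restr_to_subalg)
qed

text \<open>Completing may add sets outside \<open>M\<close>, hence the separate assumption
  \<open>A \<in> sets M\<close>. Up to a null set, \<open>A\<close> is a set \<open>S\<close> of the
  subalgebra, and on \<open>S\<close> both measures agree.\<close>

lemma emeasure_completion_restr_to_subalg:
  assumes sub: "subalgebra M F" and A: "A \<in> sets (completion (restr_to_subalg M F))"
    and AM: "A \<in> sets M"
  shows "emeasure (completion (restr_to_subalg M F)) A = emeasure M A"
proof -
  let ?R = "restr_to_subalg M F"
  obtain S N N' where SN: "A = S \<union> N" "N \<subseteq> N'" "N' \<in> null_sets ?R" "S \<in> sets ?R"
    using A by (rule sets_completionE)
  have N': "N' \<in> null_sets M"
    using SN(3) sub by (auto simp: null_sets_def sets_restr_to_subalg emeasure_restr_to_subalg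
        subalgebra_def)
  have S: "S \<in> sets M"
    using SN(4) sub by (auto simp: sets_restr_to_subalg subalgebra_def)
  have "emeasure (completion ?R) A = emeasure (completion ?R) S"
    using SN A by (intro emeasure_sandwich_null[of _ _ _ N']) (auto intro: null_sets_completionI)
  also have "\<dots> = emeasure M S"
    using SN(4) sub by (simp add: emeasure_restr_to_subalg sets_restr_to_subalg)
  also have "\<dots> = emeasure M A"
    using SN S AM N' by (intro emeasure_sandwich_null[symmetric, of _ _ _ N']) auto
  finally show ?thesis .
qed

text \<open>Restricting \<open>N\<close> to the sets of \<open>M\<close> gives back
  \<open>M\<close>, so integrability passes from a subalgebra to the full measure.\<close>

lemma integrable_if_sets_subset:
  fixes f :: "'a \<Rightarrow> 'b :: {banach, second_countable_topology}"
  assumes "space M = space N" "sets M \<subseteq> sets N"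
    and "\<And>A. A \<in> sets M \<Longrightarrow> emeasure M A = emeasure N A" and "integrable M f"
  shows "integrable N f"
proof -
  have sub: "subalgebra N M"
    using assms by (simp add: subalgebra_def)
  moreover have "restr_to_subalg N M = M"
    using assms sub by (intro measure_eqI) (simp_all add: sets_restr_to_subalg emeasure_restr_to_subalg)
  ultimately show ?thesis
    using assms(4) by (metis integrable_from_subalg)
qed

lemma integrable_indicator_mult:
  fixes f :: "'a \<Rightarrow> real"
  assumes "A \<in> sets M" "integrable M f"
  shows "integrable M (\<lambda>\<omega>. indicator A \<omega> * f \<omega>)"
  using integrable_mult_indicator[OF assms] by simp

lemma space_filt [simp]: "space (filt M X t) = space M"
  by (simp add: filt_def space_restr_to_subalg)

context finite_state_process
begin

lemma subalgebra_generated_sigma: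
  assumes "t \<le> T"
  shows "subalgebra M (generated_sigma M X t)"
proof -
  have "sets (vimage_algebra (space M) (X s) borel) \<subseteq> sets M" if "s \<le> t" for s
    using X_measurable[of s] that assms by (auto simp: sets_vimage_algebra2)
  then have "(\<Union>s\<le>t. sets (vimage_algebra (space M) (X s) borel)) \<subseteq> sets M"
    by blast
  then show ?thesis
    unfolding subalgebra_def generated_sigma_def
    using sets.space_closed[of M]
    by (auto simp: sets_measure_of dest!: sets.sigma_sets_subset)
qed

lemma sets_generated_sigma_mono:
  assumes "s \<le> t"
  shows "sets (generated_sigma M X s) \<subseteq> sets (generated_sigma M X t)"
proof -
  have sp: "(\<Union>s\<le>t. sets (vimage_algebra (space M) (X s) borel)) \<subseteq> Pow (space M)" for t
    using sets.sets_into_space by fastforce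
  show ?thesis
    unfolding generated_sigma_def
    using assms sp by (simp add: sets_measure_of) (intro sigma_sets_mono', force)
qed

lemma sets_filt_mono:
  assumes "s \<le> t" "t \<le> T"
  shows "sets (filt M X s) \<subseteq> sets (filt M X t)"
  unfolding filt_def
  using assms by (intro sets_completion_restr_to_subalg_mono subalgebra_generated_sigma
      sets_generated_sigma_mono) auto

lemma emeasure_filt:
  assumes "t \<le> T" "A \<in> sets (filt M X t)"
  shows "emeasure (filt M X t) A = emeasure M A"
proof -
  \<comment> \<open>Here \<open>sets M = sets (filt M X T)\<close> enters: all completed
    sigma-algebras up to time \<open>T\<close> lie inside \<open>M\<close>.\<close>
  have "A \<in> sets M"
    using sets_filt_mono[of t T] assms sets_M by auto
  then show ?thesis
    using assms subalgebra_generated_sigma emeasure_completion_restr_to_subalg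
    unfolding filt_def by blast
qed

lemma integrable_filt_mono:
  fixes f :: "'a \<Rightarrow> real"
  assumes "s \<le> t" "t \<le> T" "integrable (filt M X s) f"
  shows "integrable (filt M X t) f"
proof (rule integrable_if_sets_subset)
  show "sets (filt M X s) \<subseteq> sets (filt M X t)"
    using assms by (intro sets_filt_mono)
  then show "emeasure (filt M X s) A = emeasure (filt M X t) A" if "A \<in> sets (filt M X s)" for A
    using assms that by (simp add: emeasure_filt subset_iff)
qed (use assms in simp_all)

end

section \<open>Optional sampling\<close>

text \<open>Collects what the martingale argument uses about the filtration. Keeping
  \<open>G\<close> a parameter allows a second instance, with the conjugate operators, for
  submartingales.\<close>

locale filtered_g_expectation = g_expectation M F T G
  for M :: "'a measure" and F T G +
  assumes space_F: "t \<le> T \<Longrightarrow> space (F t) = space M"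
    and sets_F_mono: "s \<le> t \<Longrightarrow> t \<le> T \<Longrightarrow> sets (F s) \<subseteq> sets (F t)"
    and integrable_F_mono:
      "s \<le> t \<Longrightarrow> t \<le> T \<Longrightarrow> integrable (F s) (f :: 'a \<Rightarrow> real) \<Longrightarrow> integrable (F t) f"
begin

section \<open>Stopping times and stopped values\<close>

lemma sets_stopping_time_le:
  assumes "stopping_time F \<tau>" "s \<le> t" "t \<le> T"
  shows "{\<omega> \<in> space M. \<tau> \<omega> \<le> s} \<in> sets (F t)"
proof -
  have "{\<omega> \<in> space (F s). \<tau> \<omega> \<le> s} \<in> sets (F s)"
    using stopping_timeD[OF assms(1), of s] by (rule predE)
  then show ?thesis
    using assms sets_F_mono[of s t] by (auto simp: space_F)
qed

lemma sets_stopping_time_gr: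
  assumes "stopping_time F \<tau>" "s \<le> t" "t \<le> T"
  shows "{\<omega> \<in> space M. s < \<tau> \<omega>} \<in> sets (F t)"
proof -
  have "space (F t) - {\<omega> \<in> space M. \<tau> \<omega> \<le> s} \<in> sets (F t)"
    using sets_stopping_time_le[OF assms] by auto
  also have "space (F t) - {\<omega> \<in> space M. \<tau> \<omega> \<le> s} = {\<omega> \<in> space M. s < \<tau> \<omega>}"
    using assms by (auto simp: space_F)
  finally show ?thesis .
qed

text \<open>For a stopping time both indicators are of sets in \<open>F t\<close>, so with
  \<open>V\<close> adapted the second summand is known at time \<open>t\<close> and only the first
  involves the next value of \<open>V\<close>.\<close>

lemma at_time_min_Suc:
  assumes "\<omega> \<in> space M"
  shows "at_time V (\<lambda>\<omega>. min (\<tau> \<omega>) (Suc t)) \<omega> =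
    indicator {\<omega> \<in> space M. t < \<tau> \<omega>} \<omega> * V (Suc t) \<omega> +
    indicator {\<omega> \<in> space M. \<tau> \<omega> \<le> t} \<omega> * at_time V (\<lambda>\<omega>. min (\<tau> \<omega>) t) \<omega>"
  using assms by (auto simp: at_time_def indicator_def min_def le_Suc_eq)

text \<open>Integrability over \<open>F t\<close> includes measurability, so the stopped process is
  also adapted. The decomposition at \<open>Suc t\<close> drives a forward induction.\<close>

lemma integrable_at_time_min:
  assumes "stopping_time F \<tau>" "\<And>t. t \<le> T \<Longrightarrow> integrable (F t) (V t)" "t \<le> T"
  shows "integrable (F t) (at_time V (\<lambda>\<omega>. min (\<tau> \<omega>) t))"
  using assms(3)
proof (induction t)
  case 0
  then show ?case
    using assms(2)[of 0] by (simp add: at_time_def [abs_def])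
next
  case (Suc t)
  have 1: "integrable (F (Suc t)) (at_time V (\<lambda>\<omega>. min (\<tau> \<omega>) t))"
    by (rule integrable_F_mono[of t]) (use Suc in simp_all)
  let ?g = "\<lambda>\<omega>. indicator {\<omega> \<in> space M. t < \<tau> \<omega>} \<omega> * V (Suc t) \<omega> +
      indicator {\<omega> \<in> space M. \<tau> \<omega> \<le> t} \<omega> * at_time V (\<lambda>\<omega>. min (\<tau> \<omega>) t) \<omega>"
  have "integrable (F (Suc t)) ?g"
    using Suc.prems 1
    by (intro Bochner_Integration.integrable_add integrable_indicator_mult
        sets_stopping_time_le sets_stopping_time_gr assms) auto
  moreover have "integrable (F (Suc t)) (at_time V (\<lambda>\<omega>. min (\<tau> \<omega>) (Suc t))) \<longleftrightarrow> integrable (F (Suc t)) ?g"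
    using Suc.prems
    by (intro Bochner_Integration.integrable_cong[OF refl]) (simp add: space_F at_time_min_Suc)
  ultimately show ?case
    by blast
qed

section \<open>The supermartingale inequality\<close>

lemma supermartingale_step:
  assumes V: "g_supermartingale M F T G V" and \<tau>: "stopping_time F \<tau>" and t: "Suc t \<le> T"
  shows "AE \<omega> in M. G t (at_time V (\<lambda>\<omega>. min (\<tau> \<omega>) (Suc t))) \<omega> \<le> at_time V (\<lambda>\<omega>. min (\<tau> \<omega>) t) \<omega>"
proof -
  let ?gr = "{\<omega> \<in> space M. t < \<tau> \<omega>}" and ?le = "{\<omega> \<in> space M. \<tau> \<omega> \<le> t}"
  let ?W = "\<lambda>t. at_time V (\<lambda>\<omega>. min (\<tau> \<omega>) t)"
  let ?\<xi> = "\<lambda>\<omega>. indicator ?gr \<omega> * V (Suc t) \<omega>" and ?q = "\<lambda>\<omega>. indicator ?le \<omega> * ?W t \<omega>"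
  have intV: "integrable (F t) (V t)" if "t \<le> T" for t
    using V that by (simp add: g_supermartingale_def)
  have [simp]: "integrable (F T) f" if "integrable (F t) f \<or> integrable (F (Suc t)) f" for f :: "'a \<Rightarrow> real"
    using that t integrable_F_mono[of t T f] integrable_F_mono[of "Suc t" T f] by auto
  have W: "integrable (F s) (?W s)" if "s \<le> T" for s
    using \<tau> intV that by (rule integrable_at_time_min)
  have \<xi>: "integrable (F (Suc t)) ?\<xi>"
    using t \<tau> intV
    by (intro integrable_indicator_mult sets_stopping_time_gr) auto
  have q: "integrable (F t) ?q"
    using t \<tau> W
    by (intro integrable_indicator_mult sets_stopping_time_le) auto
  \<comment> \<open>The decomposition of \<open>?W (Suc t)\<close> is available on
    \<open>space M\<close> only, not as an identity of functions, so it is passed under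
    \<open>G t\<close> by monotonicity.\<close>
  have "AE \<omega> in M. G t (\<lambda>\<omega>. ?\<xi> \<omega> + ?q \<omega>) \<omega> \<ge> G t (?W (Suc t)) \<omega>"
    using t W[of "Suc t"] \<xi> q
    by (intro G_mono AE_I2 Bochner_Integration.integrable_add) (auto simp: at_time_min_Suc)
  moreover have "AE \<omega> in M. G t (\<lambda>\<omega>. ?\<xi> \<omega> + ?q \<omega>) \<omega> = G t ?\<xi> \<omega> + ?q \<omega>"
    using t \<xi> q by (intro G_translation) auto
  moreover have "AE \<omega> in M. indicator ?gr \<omega> * G t (V (Suc t)) \<omega> = G t ?\<xi> \<omega>"
    using t \<tau> intV[of "Suc t"] by (intro G_indicator sets_stopping_time_gr) auto
  moreover have "AE \<omega> in M. V t \<omega> \<ge> G t (V (Suc t)) \<omega>"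
    using V t by (simp add: g_supermartingale_def)
  ultimately show ?thesis
    using AE_space
  proof eventually_elim
    case (elim \<omega>)
    show ?case
    \<comment> \<open>If \<open>\<tau> \<omega> \<le> t\<close>, then \<open>G t ?\<xi>\<close>
      vanishes and \<open>?q\<close> is \<open>?W t\<close>. Otherwise \<open>?q\<close> vanishes
      and \<open>G t ?\<xi>\<close> is \<open>G t (V (Suc t))\<close>, at most \<open>V t\<close>,
      which is \<open>?W t\<close>.\<close>
    proof (cases "\<tau> \<omega> \<le> t")
      case True
      then show ?thesis using elim by (simp add: min_def)
    next
      case False
      then show ?thesis using elim by (simp add: at_time_def)
    qed
  qed
qed

lemma supermartingale_at_time_le:
  assumes V: "g_supermartingale M F T G V" and \<tau>: "stopping_time F \<tau>"
    and le_T: "\<And>\<omega>. \<omega> \<in> space M \<Longrightarrow> \<tau> \<omega> \<le> T" and t: "t \<le> T"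
  shows "AE \<omega> in M. G t (at_time V \<tau>) \<omega> \<le> at_time V (\<lambda>\<omega>. min (\<tau> \<omega>) t) \<omega>"
proof -
  let ?W = "\<lambda>t. at_time V (\<lambda>\<omega>. min (\<tau> \<omega>) t)"
  have W: "integrable (F s) (?W s)" if "s \<le> T" for s
    using \<tau> _ that by (rule integrable_at_time_min) (use V in \<open>simp add: g_supermartingale_def\<close>)
  have W_T: "?W T \<omega> = at_time V \<tau> \<omega>" if "\<omega> \<in> space M" for \<omega>
    using le_T[OF that] by (simp add: at_time_def min_absorb1)
  have "integrable (F T) (at_time V \<tau>) \<longleftrightarrow> integrable (F T) (?W T)"
    by (intro Bochner_Integration.integrable_cong[OF refl]) (simp add: space_F W_T)
  then have int: "integrable (F T) (at_time V \<tau>)"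
    using W[of T] by simp
  show ?thesis
    using t
  \<comment> \<open>The induction runs down from \<open>T\<close>, where the stopped value is
    \<open>at_time V \<tau>\<close> itself and \<open>G T\<close> fixes it.\<close>
  proof (induction t rule: inc_induct)
    case base
    have "AE \<omega> in M. G T (at_time V \<tau>) \<omega> = at_time V \<tau> \<omega>"
      using int by (intro G_measurable_id) auto
    then show ?case
      using AE_space by eventually_elim (simp add: W_T)
  next
    case (step t)
    let ?\<xi> = "G (Suc t) (at_time V \<tau>)"
    have "integrable (F T) ?\<xi>" "integrable (F T) (?W (Suc t))"
      using step(2) int G_integrable W integrable_F_mono[of "Suc t" T] by simp_all
    \<comment> \<open>\<open>G t\<close> is applied to the induction hypothesis; the tower property
      then simplifies \<open>G t ?\<xi>\<close>, and the one-step bound leads from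
      \<open>?W (Suc t)\<close> to \<open>?W t\<close>.\<close>
    then have "AE \<omega> in M. G t (?W (Suc t)) \<omega> \<ge> G t ?\<xi> \<omega>"
      using step by (intro G_mono) auto
    moreover have "AE \<omega> in M. G t ?\<xi> \<omega> = G t (at_time V \<tau>) \<omega>"
      using step(2) int by (intro G_tower) auto
    moreover have "AE \<omega> in M. G t (?W (Suc t)) \<omega> \<le> ?W t \<omega>"
      using step(2) by (intro supermartingale_step[OF V \<tau>]) auto
    ultimately show ?case
      by eventually_elim linarith
  qed
qed

lemma G_stopped_eq:
  assumes "\<sigma> \<omega> \<le> T"
  shows "G_stopped T G \<sigma> \<xi> \<omega> = G (\<sigma> \<omega>) \<xi> \<omega>"
proof -
  have "G_stopped T G \<sigma> \<xi> \<omega> = (\<Sum>t\<le>T. if \<sigma> \<omega> = t then G t \<xi> \<omega> else 0)"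
    unfolding G_stopped_def by (rule sum.cong) (simp_all add: indicator_def)
  then show ?thesis
    using assms by simp
qed

lemma supermartingale_optional_sampling:
  assumes V: "g_supermartingale M F T G V" and \<tau>: "stopping_time F \<tau>"
    and le: "\<And>\<omega>. \<omega> \<in> space M \<Longrightarrow> \<sigma> \<omega> \<le> \<tau> \<omega> \<and> \<tau> \<omega> \<le> T"
  shows "AE \<omega> in M. G_stopped T G \<sigma> (at_time V \<tau>) \<omega> \<le> at_time V \<sigma> \<omega>"
proof -
  \<comment> \<open>Each \<open>t\<close> has its own null set; as there are finitely many times,
    one null set serves all, and the bound may be read at the random time
    \<open>\<sigma> \<omega>\<close>.\<close>
  have "AE \<omega> in M. \<forall>t\<in>{..T}. G t (at_time V \<tau>) \<omega> \<le> at_time V (\<lambda>\<omega>. min (\<tau> \<omega>) t) \<omega>"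
    using le by (intro AE_finite_allI supermartingale_at_time_le[OF V \<tau>]) auto
  then show ?thesis
    using AE_space
  proof eventually_elim
    case (elim \<omega>)
    then have "\<sigma> \<omega> \<le> T" "\<sigma> \<omega> \<le> \<tau> \<omega>"
      using le[of \<omega>] by auto
    then show ?case
      using elim(1)[rule_format, of "\<sigma> \<omega>"] by (simp add: G_stopped_eq at_time_def min_absorb2)
  qed
qed

section \<open>The conjugate expectation and submartingales\<close>

definition dual :: "nat \<Rightarrow> ('a \<Rightarrow> real) \<Rightarrow> 'a \<Rightarrow> real" where
  "dual t \<xi> = (\<lambda>\<omega>. - G t (\<lambda>\<omega>. - \<xi> \<omega>) \<omega>)"

text \<open>Monotonicity survives because the order is reversed twice, and in the tower property the
  two inner signs cancel. The other axioms are those of \<open>G\<close> at negated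
  arguments.\<close>

lemma filtered_g_expectation_dual: "filtered_g_expectation M F T dual"
proof
  fix t and \<xi> :: "'a \<Rightarrow> real" assume "t \<le> T" "integrable (F T) \<xi>"
  then show "integrable (F t) (dual t \<xi>)"
    by (auto simp: dual_def intro: G_integrable)
next
  fix t and \<xi> \<xi>' :: "'a \<Rightarrow> real" assume "t \<le> T" "integrable (F T) \<xi>" "integrable (F T) \<xi>'" "AE \<omega> in M. \<xi>' \<omega> \<le> \<xi> \<omega>"
  then show "AE \<omega> in M. dual t \<xi>' \<omega> \<le> dual t \<xi> \<omega>"
    using G_mono[of t "\<lambda>\<omega>. - \<xi>' \<omega>" "\<lambda>\<omega>. - \<xi> \<omega>"] by (simp add: dual_def)
next
  fix t and \<xi> :: "'a \<Rightarrow> real" assume "t \<le> T" "integrable (F T) \<xi>" "\<xi> \<in> borel_measurable (F t)"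
  then have "AE \<omega> in M. G t (\<lambda>\<omega>. - \<xi> \<omega>) \<omega> = - \<xi> \<omega>"
    by (intro G_measurable_id) auto
  then show "AE \<omega> in M. dual t \<xi> \<omega> = \<xi> \<omega>"
    unfolding dual_def by eventually_elim simp
next
  fix s t and \<xi> :: "'a \<Rightarrow> real" assume "s < t" "t \<le> T" "integrable (F T) \<xi>"
  then show "AE \<omega> in M. dual s (dual t \<xi>) \<omega> = dual s \<xi> \<omega>"
    using G_tower[of s t "\<lambda>\<omega>. - \<xi> \<omega>"] by (simp add: dual_def)
next
  fix t A and \<xi> :: "'a \<Rightarrow> real" assume "t \<le> T" "integrable (F T) \<xi>" "A \<in> sets (F t)"
  then show "AE \<omega> in M. indicator A \<omega> * dual t \<xi> \<omega> = dual t (\<lambda>\<omega>. indicator A \<omega> * \<xi> \<omega>) \<omega>"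
    using G_indicator[of t "\<lambda>\<omega>. - \<xi> \<omega>" A] by (simp add: dual_def)
next
  fix t and \<xi> q :: "'a \<Rightarrow> real" assume "t \<le> T" "integrable (F T) \<xi>" "integrable (F t) q"
  then have "AE \<omega> in M. G t (\<lambda>\<omega>. - \<xi> \<omega> + - q \<omega>) \<omega> = G t (\<lambda>\<omega>. - \<xi> \<omega>) \<omega> + - q \<omega>"
    by (intro G_translation) auto
  then show "AE \<omega> in M. dual t (\<lambda>\<omega>. \<xi> \<omega> + q \<omega>) \<omega> = dual t \<xi> \<omega> + q \<omega>"
    unfolding dual_def minus_add_distrib by eventually_elim simp
qed (fact space_F sets_F_mono integrable_F_mono)+

lemma submartingale_optional_sampling:
  assumes V: "g_submartingale M F T G V" and \<tau>: "stopping_time F \<tau>"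
    and le: "\<And>\<omega>. \<omega> \<in> space M \<Longrightarrow> \<sigma> \<omega> \<le> \<tau> \<omega> \<and> \<tau> \<omega> \<le> T"
  shows "AE \<omega> in M. at_time V \<sigma> \<omega> \<le> G_stopped T G \<sigma> (at_time V \<tau>) \<omega>"
proof -
  interpret dual: filtered_g_expectation M F T dual
    by (rule filtered_g_expectation_dual)
  \<comment> \<open>Negating \<open>V s \<le> G s (V t)\<close> gives
    \<open>- V s \<ge> - G s (V t)\<close>, whose right side is \<open>dual s\<close> of
    \<open>- V t\<close> because the inner signs cancel.\<close>
  have "g_supermartingale M F T dual (\<lambda>t \<omega>. - V t \<omega>)"
    using V by (simp add: g_supermartingale_def g_submartingale_def dual_def)
  from dual.supermartingale_optional_sampling[OF this \<tau> le]
  show ?thesis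
    by (simp add: G_stopped_def dual_def at_time_def [abs_def] sum_negf)
qed

end

theorem theorem3p6:
  fixes M :: "'a measure" and X :: "nat \<Rightarrow> 'a \<Rightarrow> real ^ 'm" and T :: nat
    and G :: "nat \<Rightarrow> ('a \<Rightarrow> real) \<Rightarrow> 'a \<Rightarrow> real"
    and V :: "nat \<Rightarrow> 'a \<Rightarrow> real" and \<sigma> \<tau> :: "'a \<Rightarrow> nat"
  assumes "finite_state_process M X T"
    and "g_expectation M (filt M X) T G"
    and "stopping_time (filt M X) \<sigma>" and "stopping_time (filt M X) \<tau>"
    and "\<And>\<omega>. \<omega> \<in> space M \<Longrightarrow> \<sigma> \<omega> \<le> \<tau> \<omega> \<and> \<tau> \<omega> \<le> T"
  shows "(g_supermartingale M (filt M X) T G V \<longrightarrow>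
            (AE \<omega> in M. at_time V \<sigma> \<omega> \<ge> G_stopped T G \<sigma> (at_time V \<tau>) \<omega>)) \<and>
         (g_submartingale M (filt M X) T G V \<longrightarrow>
            (AE \<omega> in M. at_time V \<sigma> \<omega> \<le> G_stopped T G \<sigma> (at_time V \<tau>) \<omega>))"
proof -
  interpret finite_state_process M X T by fact
  interpret g_expectation M "filt M X" T G by fact
  interpret filtered_g_expectation M "filt M X" T G
    by unfold_locales (simp_all add: sets_filt_mono integrable_filt_mono)
  show ?thesis
    using supermartingale_optional_sampling submartingale_optional_sampling assms(4,5) by blast
qed

end
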